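(* For any tree $T$, $L_1(T)+1\leq L_2(T)\leq 2L_1(T)$. Moreover, $L_1(T)+1= L_2(T)$ if and only if $T$ is a $t$-spider for some integer $t$ with $0\leq t<\Delta(T)$.
   Context: All graphs (in particular trees) are finite, undirected, simple and nontrivial (at least two vertices). $\Delta(T)$ is the maximum degree. A star is a tree with diameter at most $2$. A $t$-spider is a tree obtained from a star by subdividing $t$ of its edges once each. $N[v]=\{v\}\cup N(v)$ is the closed neighbourhood of $v$. For an integer $k\ge 1$, a set $B\subseteq V(G)$ is a $k$-limited packing if $|N[v]\cap B|\le k$ for every vertex $v$ of $G$; $L_k(G)$ is the maximum cardinality of a $k$-limited packing in $G$. *)

theory Defs
  imports "Graph_Theory.Graph_Theory"
begin

text \<open>
  As usual in this library, a finite simple undirected graph is a finite, symmetric, loop-free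
  digraph whose arcs are pairs of vertices (locale \<^locale>\<open>pair_graph\<close>); the undirected edge
  \<open>uv\<close> is the pair of arcs \<open>(u,v)\<close>, \<open>(v,u)\<close>.
\<close>

definition nontrivial_graph :: "'a pair_pre_digraph \<Rightarrow> bool" where
  "nontrivial_graph G \<longleftrightarrow> pair_graph G \<and> 2 \<le> card (pverts G)"

text \<open>
  \<^const>\<open>tree\<close> is unsuitable for undirected graphs: the two arcs of a single undirected edge
  already form a \<^const>\<open>pre_digraph.cycle\<close>. An undirected cycle is one of length at least 3.
\<close>

definition undirected_tree :: "'a pair_pre_digraph \<Rightarrow> bool" where
  "undirected_tree G \<longleftrightarrow> nontrivial_graph G \<and> Digraph_Component.connected (with_proj G) \<and>
     \<not> (\<exists>p. pre_digraph.cycle (with_proj G) p \<and> 3 \<le> length p)"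

text \<open>In a \<^locale>\<open>pair_graph\<close> the out-degree of a vertex is its number of neighbours.\<close>

definition max_degree :: "'a pair_pre_digraph \<Rightarrow> nat" where
  "max_degree G = Max (out_degree (with_proj G) ` pverts G)"

text \<open>With unit weights, \<^const>\<open>wf_digraph.\<mu>\<close> is the usual distance.\<close>

definition diameter :: "'a pair_pre_digraph \<Rightarrow> ereal" where
  "diameter G = (SUP u\<in>pverts G. SUP v\<in>pverts G. wf_digraph.\<mu> (with_proj G) (\<lambda>_. 1) u v)"

definition star :: "'a pair_pre_digraph \<Rightarrow> bool" where
  "star G \<longleftrightarrow> undirected_tree G \<and> diameter G \<le> 2"

text \<open>
  The edges \<open>es\<close> of the star \<open>S\<close>, pairwise distinct as undirected edges, are subdivided by the
  pairwise distinct new vertices \<open>ws\<close>. Since \<open>T\<close> contains the vertices of \<open>S\<close>, equality may be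
  demanded here instead of isomorphism.
\<close>

definition spider :: "nat \<Rightarrow> 'a pair_pre_digraph \<Rightarrow> bool" where
  "spider t T \<longleftrightarrow> (\<exists>S es ws. star S \<and>
     length es = t \<and> set es \<subseteq> parcs S \<and> distinct (map (\<lambda>(u, v). {u, v}) es) \<and>
     length ws = t \<and> set ws \<inter> pverts S = {} \<and> distinct ws \<and>
     T = fold (\<lambda>(e, w) G. subdivide G e w) (zip es ws) S)"

definition closed_nbhd :: "'a pair_pre_digraph \<Rightarrow> 'a \<Rightarrow> 'a set" where
  "closed_nbhd G v = insert v {u. (v, u) \<in> parcs G}"

definition limited_packing :: "nat \<Rightarrow> 'a pair_pre_digraph \<Rightarrow> 'a set \<Rightarrow> bool" where
  "limited_packing k G B \<longleftrightarrow>
     B \<subseteq> pverts G \<and> (\<forall>v\<in>pverts G. card (closed_nbhd G v \<inter> B) \<le> k)"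

definition limited_packing_number :: "nat \<Rightarrow> 'a pair_pre_digraph \<Rightarrow> nat" where
  "limited_packing_number k G = Max (card ` {B. limited_packing k G B})"

end

theory Submission
  imports Defs
begin

text \<open>
  Root the tree. If distinct \<open>x\<close>, \<open>y\<close> lie in a common closed neighbourhood and \<open>y\<close> is at least as deep
  as \<open>x\<close>, then both lie in the closed neighbourhood of the parent of \<open>y\<close>. Hence the
  conflict graph of a 2-limited packing is 1-degenerate, so 2-colourable, and the larger colour
  class is a 1-limited packing of at least half the size; and sets of vertices that pairwise share a
  closed neighbourhood lie in a single one.

  Adding any vertex to a 1-limited packing gives a 2-limited one. If \<open>L\<^sub>2 = L\<^sub>1 + 1\<close>, no two vertices can
  be added to a maximum 1-limited packing \<open>B\<close>; so any two vertices outside \<open>B\<close> lie in a closed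
  neighbourhood that meets \<open>B\<close>. Thus all vertices outside \<open>B\<close> lie in some \<open>N[c]\<close>, and the vertices
  outside \<open>N[c]\<close> are leaves hanging from distinct neighbours of \<open>c\<close>: the tree is a spider.
  Conversely, if \<open>t\<close> edges at \<open>c\<close> are subdivided and some edge is not, the \<open>t\<close> far leaves and one
  near leaf give \<open>L\<^sub>1 \<ge> t + 1\<close>, and \<open>L\<^sub>2 \<le> t + 2\<close> because \<open>N[c]\<close> misses only the far leaves.
  If all edges at \<open>c\<close> are subdivided, \<open>t < \<Delta>(T)\<close> leaves only the path with three vertices.
\<close>

section \<open>Parents and depths in a tree\<close>

text \<open>Keeping the path inside \<open>S\<close> lets a vertex outside \<open>S\<close> be
  attached to it later without repetition. If the new first vertex already lies on the path, the
  part of the path from there on is taken instead.\<close>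

lemma (in pair_wf_digraph) apath_within:
  assumes "(x, y) \<in> (parcs G \<inter> S \<times> S)\<^sup>*" "y \<in> S" "y \<in> pverts G"
  obtains q where "apath x q y" "set (awalk_verts x q) \<subseteq> S"
proof -
  have "\<exists>q. apath x q y \<and> set (awalk_verts x q) \<subseteq> S"
    using assms(1)
  proof (induction rule: converse_rtrancl_induct)
    case base
    then show ?case using assms by (intro exI[of _ "[]"]) (auto simp: apath_Nil_iff)
  next
    case (step x w)
    then obtain q where q: "apath w q y" "set (awalk_verts w q) \<subseteq> S" by auto
    show ?case
    proof (cases "x \<in> set (awalk_verts w q)")
      case True
      obtain q1 q2 where *: "q = q1 @ q2" "awalk w q1 x" "awalk x q2 y"
        using awalk_decomp[OF awalkI_apath[OF q(1)] True] by blast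
      have "awlast w q1 = x" using *(2) by auto
      then have "apath x q2 y" using q(1) unfolding *(1) apath_append_iff by auto
      moreover have "set (awalk_verts x q2) \<subseteq> S"
        using q(2) set_awalk_verts_append[OF *(2,3)] *(1) by auto
      ultimately show ?thesis by blast
    next
      case False
      then have "apath x ((x, w) # q) y" using step q by (auto simp: apath_Cons_iff)
      then show ?thesis using q step by (intro exI[of _ "(x, w) # q"]) auto
    qed
  qed
  then show ?thesis using that by blast
qed

text \<open>A simple path from \<open>u\<close> to \<open>v\<close> inside \<open>S\<close> is
  closed up through \<open>z\<close>. The path has at least one arc because \<open>u\<close> and
  \<open>v\<close> differ, so the cycle has at least three.\<close>

lemma (in pair_sym_digraph) cycle_through_two_arcs:
  assumes "(u, v) \<in> (parcs G \<inter> S \<times> S)\<^sup>*" "u \<in> S" "v \<in> S" "u \<noteq> v"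
    and "(u, z) \<in> parcs G" "(v, z) \<in> parcs G" "z \<notin> S"
  shows "\<exists>p. cycle p \<and> 3 \<le> length p"
proof -
  obtain q where q: "apath u q v" "set (awalk_verts u q) \<subseteq> S"
    using apath_within assms by (metis in_arcsD1)
  have aw: "awalk u q v" and dist: "distinct (awalk_verts u q)" using q(1) by (auto simp: apath_def)
  have ne: "q \<noteq> []" using aw assms(4) by (auto simp: awalk_Nil_iff)
  let ?p = "q @ [(v, z), (z, u)]"
  have last: "awlast u q = v" using aw by auto
  have w: "awalk u ?p u"
    using aw assms last by (auto simp: awalk_simps dest: in_arcsD1 arcs_symmetric)
  have "awalk_verts u ?p = awalk_verts u q @ [z, u]"
    using awalk_verts_append[OF w] last by simp
  moreover obtain l where "awalk_verts u q = u # l"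
    using aw by (cases q) (auto simp: awalk_Cons_iff)
  ultimately have "distinct (tl (awalk_verts u ?p))"
    using dist q(2) assms(2,7) by auto
  then have "cycle ?p" unfolding cycle_def using w by blast
  moreover have "3 \<le> length ?p" using ne by (cases q) auto
  ultimately show ?thesis by blast
qed

text \<open>The last clause encodes acyclicity. \<open>S\<close> is a parameter so that the
  structure can be built one vertex at a time.\<close>

definition parent_structure :: "'a rel \<Rightarrow> 'a set \<Rightarrow> 'a \<Rightarrow> ('a \<Rightarrow> 'a) \<Rightarrow> ('a \<Rightarrow> nat) \<Rightarrow> bool" where
  "parent_structure E S r p d \<longleftrightarrow> r \<in> S \<and>
     (\<forall>x\<in>S - {r}. p x \<in> S \<and> (x, p x) \<in> E \<and> d x = Suc (d (p x))) \<and>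
     (\<forall>x\<in>S. \<forall>y\<in>S. (x, y) \<in> E \<longrightarrow> x \<noteq> r \<and> y = p x \<or> y \<noteq> r \<and> x = p y)"

lemma undirected_treeD:
  assumes "undirected_tree T"
  shows "pair_graph T" "2 \<le> card (pverts T)" "finite (pverts T)"
    "\<And>u v. (u, v) \<in> parcs T \<Longrightarrow> u \<in> pverts T" "\<And>u v. (u, v) \<in> parcs T \<Longrightarrow> v \<in> pverts T"
    "\<And>u v. (u, v) \<in> parcs T \<Longrightarrow> (v, u) \<in> parcs T" "\<And>u. (u, u) \<notin> parcs T"
    "\<And>u v. u \<in> pverts T \<Longrightarrow> v \<in> pverts T \<Longrightarrow> (u, v) \<in> (parcs T)\<^sup>*"
    "\<And>p. pre_digraph.cycle (with_proj T) p \<Longrightarrow> length p < 3"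
proof -
  show "pair_graph T" "2 \<le> card (pverts T)" using assms by (auto simp: undirected_tree_def nontrivial_graph_def)
  then interpret pair_graph T by simp
  show "finite (pverts T)" by auto
  show sym: "\<And>u v. (u, v) \<in> parcs T \<Longrightarrow> u \<in> pverts T" "\<And>u v. (u, v) \<in> parcs T \<Longrightarrow> v \<in> pverts T"
    "\<And>u v. (u, v) \<in> parcs T \<Longrightarrow> (v, u) \<in> parcs T" "\<And>u. (u, u) \<notin> parcs T"
    by (auto dest: in_arcsD1 in_arcsD2 arcs_symmetric no_loops')
  \<comment> \<open>The graph is already symmetric, so connectedness is strong connectedness of
    \<open>T\<close> itself.\<close>
  have mk: "parcs (mk_symmetric (with_proj T)) = parcs T" "pverts (mk_symmetric (with_proj T)) = pverts T"
    using sym(3) by (auto simp: mk_symmetric_def)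
  have "strongly_connected (with_proj (mk_symmetric (with_proj T)))"
    using assms by (simp add: undirected_tree_def Digraph_Component.connected_def)
  then show "(u, v) \<in> (parcs T)\<^sup>*" if "u \<in> pverts T" "v \<in> pverts T" for u v
    using that mk unfolding strongly_connected_def reachable_def with_proj_simps
    by (metis rtrancl_on_rtranclI)
  show "\<And>p. pre_digraph.cycle (with_proj T) p \<Longrightarrow> length p < 3"
    using assms by (auto simp: undirected_tree_def not_le)
qed

text \<open>\<open>S\<close> grows from a single vertex, each time by an adjacent vertex
  \<open>z\<close> whose neighbour in \<open>S\<close> becomes its parent. Mutual reachability
  inside \<open>S\<close> belongs to the induction claim because it turns a second neighbour of
  \<open>z\<close> in \<open>S\<close> into a cycle.\<close>

lemma ex_parent_structure:
  assumes "undirected_tree T"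
  obtains r p d where "parent_structure (parcs T) (pverts T) r p d"
proof -
  note T = undirected_treeD[OF assms]
  interpret pair_graph T by (rule T(1))
  let ?E = "parcs T"
  have "\<exists>S r p d. S \<subseteq> pverts T \<and> card S = Suc n \<and> parent_structure ?E S r p d \<and>
      (\<forall>x\<in>S. \<forall>y\<in>S. (x, y) \<in> (?E \<inter> S \<times> S)\<^sup>*)" if "Suc n \<le> card (pverts T)" for n
    using that
  proof (induction n)
    case 0
    then obtain r where r: "r \<in> pverts T" by fastforce
    have "parent_structure ?E {r} r id (\<lambda>_. 0)" using T(7) by (auto simp: parent_structure_def)
    then show ?case using r by (intro exI[of _ "{r}"] exI[of _ r]) auto
  next
    case (Suc n)
    then obtain S r p d where S: "S \<subseteq> pverts T" "card S = Suc n" "parent_structure ?E S r p d"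
      "\<And>x y. x \<in> S \<Longrightarrow> y \<in> S \<Longrightarrow> (x, y) \<in> (?E \<inter> S \<times> S)\<^sup>*" by auto
    have r: "r \<in> S" using S(3) by (auto simp: parent_structure_def)
    have "S \<noteq> pverts T" using S(2) Suc.prems by auto
    then obtain v where v: "v \<in> pverts T" "v \<notin> S" using S(1) by auto
    \<comment> \<open>If no arc left \<open>S\<close>, everything reachable from \<open>r\<close>
      would stay in \<open>S\<close>, against connectedness.\<close>
    have "\<exists>u z. u \<in> S \<and> z \<notin> S \<and> (u, z) \<in> ?E"
    proof (rule ccontr)
      assume *: "\<not> ?thesis"
      have "x \<in> S" if "(r, x) \<in> ?E\<^sup>*" for x
        using that by induction (use * r in auto)
      then show False using T(8)[of r v] v r S(1) by auto
    qed
    then obtain u z where u: "u \<in> S" "z \<notin> S" "(u, z) \<in> ?E" by auto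
    have uniq: "x = u" if "x \<in> S" "(x, z) \<in> ?E" for x
    proof (rule ccontr)
      assume "x \<noteq> u"
      then have "\<exists>p. cycle p \<and> 3 \<le> length p"
        using cycle_through_two_arcs[OF S(4)[OF that(1) u(1)]] that u by blast
      then show False using T(9) by fastforce
    qed
    let ?S = "insert z S"
    have "parent_structure ?E ?S r (p(z := u)) (d(z := Suc (d u)))"
      unfolding parent_structure_def
    proof (intro conjI ballI impI)
      show "r \<in> ?S" using r by simp
    next
      fix x assume "x \<in> ?S - {r}"
      then show "(p(z := u)) x \<in> ?S" "(x, (p(z := u)) x) \<in> ?E"
         "(d(z := Suc (d u))) x = Suc ((d(z := Suc (d u))) ((p(z := u)) x))"
        using S(3) u T(6) by (auto simp: parent_structure_def)
    next
      fix x y assume "x \<in> ?S" "y \<in> ?S" "(x, y) \<in> ?E"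
      then consider "x = z" "y = u" | "x = u" "y = z" | "x \<in> S" "y \<in> S" "x \<noteq> z" "y \<noteq> z"
        using uniq T(6,7) u(2) by blast
      then show "x \<noteq> r \<and> y = (p(z := u)) x \<or> y \<noteq> r \<and> x = (p(z := u)) y"
      proof cases
        case 3
        then show ?thesis using S(3) \<open>(x, y) \<in> ?E\<close> unfolding parent_structure_def by simp
      qed (use r u in auto)
    qed
    moreover have "(x, y) \<in> (?E \<inter> ?S \<times> ?S)\<^sup>*" if "x \<in> ?S" "y \<in> ?S" for x y
    proof -
      have mono: "(?E \<inter> S \<times> S)\<^sup>* \<subseteq> (?E \<inter> ?S \<times> ?S)\<^sup>*" by (intro rtrancl_mono) auto
      have uz: "(u, z) \<in> ?E \<inter> ?S \<times> ?S" "(z, u) \<in> ?E \<inter> ?S \<times> ?S" using u T(6) by auto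
      have "(x, u) \<in> (?E \<inter> ?S \<times> ?S)\<^sup>*" using that(1) S(4) u(1) mono uz(2) by blast
      moreover have "(u, y) \<in> (?E \<inter> ?S \<times> ?S)\<^sup>*" using that(2) S(4) u(1) mono uz(1) by blast
      ultimately show ?thesis by simp
    qed
    moreover have "card ?S = Suc (Suc n)" using S(2) u(2) by (simp add: card_gt_0_iff[THEN iffD1])
    moreover have "?S \<subseteq> pverts T" using S(1) u(3) T(5) by auto
    ultimately show ?case by blast
  qed
  from this[of "card (pverts T) - 1"] obtain S r p d where "S \<subseteq> pverts T" "card S = card (pverts T)"
    "parent_structure ?E S r p d" using T(2) by auto
  then show ?thesis using that card_subset_eq[OF T(3)] by blast
qed

lemma parent_structure_arc:
  assumes "parent_structure (parcs T) (pverts T) r p d" "undirected_tree T" "(x, y) \<in> parcs T"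
  shows "x \<noteq> r \<and> y = p x \<and> d x = Suc (d y) \<or> y \<noteq> r \<and> x = p y \<and> d y = Suc (d x)"
proof -
  have "x \<in> pverts T" "y \<in> pverts T" using undirected_treeD(4,5)[OF assms(2,3)] by auto
  then show ?thesis using assms(1,3) unfolding parent_structure_def by blast
qed

text \<open>The new centre depends on \<open>y\<close> alone, so one centre serves every
  \<open>x\<close> at once. If \<open>v\<close> is neither \<open>x\<close> nor \<open>y\<close>, it
  cannot be a child of \<open>y\<close>: then \<open>x\<close>, being another neighbour of
  \<open>v\<close>, would be deeper than \<open>y\<close>.\<close>

lemma parent_structure_key:
  assumes "parent_structure (parcs T) (pverts T) r p d" "undirected_tree T"
    and "v \<in> pverts T" "x \<in> closed_nbhd T v" "y \<in> closed_nbhd T v" "x \<noteq> y" "d x \<le> d y"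
  shows "y \<noteq> r \<and> p y \<in> pverts T \<and> x \<in> closed_nbhd T (p y) \<and> y \<in> closed_nbhd T (p y)"
proof -
  note T = undirected_treeD[OF assms(2)]
  have mem: "x \<in> pverts T" "y \<in> pverts T" using assms(3-5) T(5) by (auto simp: closed_nbhd_def)
  note up = parent_structure_arc[OF assms(1,2)]
  have par: "p y \<in> pverts T \<and> (y, p y) \<in> parcs T" if "y \<noteq> r"
    using that assms(1) mem(2) unfolding parent_structure_def by blast
  have "y \<noteq> r \<and> (x = p y \<or> (p y, x) \<in> parcs T)"
  proof (cases "v = x \<or> v = y")
    case True
    then have "(x, y) \<in> parcs T" using assms(4-6) T(6) by (auto simp: closed_nbhd_def)
    from up[OF this] show ?thesis using assms(7) by auto
  next
    case False
    then have e: "(v, x) \<in> parcs T" "(v, y) \<in> parcs T" using assms(4,5) by (auto simp: closed_nbhd_def)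
    show ?thesis using up[OF e(1)] up[OF e(2)] e assms(6,7) by auto
  qed
  then show ?thesis using par T(6) by (auto simp: closed_nbhd_def)
qed

text \<open>The parity of the depth changes along every arc, which cannot happen three times around
  a triangle.\<close>

lemma tree_no_triangle:
  assumes "undirected_tree T" "(x, y) \<in> parcs T" "(y, z) \<in> parcs T" "(x, z) \<in> parcs T"
  shows False
proof -
  obtain r p d where P: "parent_structure (parcs T) (pverts T) r p d"
    using ex_parent_structure[OF assms(1)] .
  note up = parent_structure_arc[OF P assms(1)]
  have "d x = Suc (d y) \<or> d y = Suc (d x)" "d y = Suc (d z) \<or> d z = Suc (d y)"
    "d x = Suc (d z) \<or> d z = Suc (d x)"
    using up assms(2-4) by blast+
  then show False by presburger
qed

text \<open>Of two distinct vertices, the one that is at least as deep has every common neighbour as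
  its parent.\<close>

lemma tree_unique_common_neighbour:
  assumes "undirected_tree T" "x \<noteq> y"
    and "(u, x) \<in> parcs T" "(u, y) \<in> parcs T" "(v, x) \<in> parcs T" "(v, y) \<in> parcs T"
  shows "u = v"
proof -
  obtain r p d where P: "parent_structure (parcs T) (pverts T) r p d"
    using ex_parent_structure[OF assms(1)] .
  note up = parent_structure_arc[OF P assms(1)]
  show ?thesis using up[OF assms(3)] up[OF assms(4)] up[OF assms(5)] up[OF assms(6)] assms(2)
    by (elim disjE conjE; (linarith | metis))
qed

section \<open>Limited packings in trees\<close>

lemma limited_packing_le:
  assumes "finite (pverts T)" "limited_packing k T B"
  shows "card B \<le> limited_packing_number k T"
proof -
  have "finite {B. limited_packing k T B}"
    by (rule finite_subset[of _ "Pow (pverts T)"]) (use assms in \<open>auto simp: limited_packing_def\<close>)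
  then show ?thesis unfolding limited_packing_number_def using assms(2) by simp
qed

lemma ex_maximum_limited_packing:
  assumes "finite (pverts T)"
  obtains B where "limited_packing k T B" "card B = limited_packing_number k T"
proof -
  have "finite {B. limited_packing k T B}"
    by (rule finite_subset[of _ "Pow (pverts T)"]) (use assms in \<open>auto simp: limited_packing_def\<close>)
  moreover have "{} \<in> {B. limited_packing k T B}" by (simp add: limited_packing_def)
  ultimately have "limited_packing_number k T \<in> card ` {B. limited_packing k T B}"
    unfolding limited_packing_number_def by (intro Max_in) auto
  then show ?thesis using that by auto
qed

lemma limited_packing_1_iff:
  assumes "finite (pverts T)"
  shows "limited_packing 1 T B \<longleftrightarrow> B \<subseteq> pverts T \<and>
    (\<forall>v\<in>pverts T. \<forall>x\<in>closed_nbhd T v \<inter> B. \<forall>y\<in>closed_nbhd T v \<inter> B. x = y)"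
proof (cases "B \<subseteq> pverts T")
  case True
  then have "finite (closed_nbhd T v \<inter> B)" for v using assms by (meson finite_Int finite_subset)
  then show ?thesis using True by (simp add: limited_packing_def card_le_Suc0_iff_eq)
qed (simp add: limited_packing_def)

lemma limited_packing_insert:
  assumes "finite (pverts T)" "limited_packing k T B" "x \<in> pverts T"
  shows "limited_packing (Suc k) T (insert x B)"
  unfolding limited_packing_def
proof (intro conjI ballI)
  fix v assume "v \<in> pverts T"
  then have "card (closed_nbhd T v \<inter> B) \<le> k" using assms by (auto simp: limited_packing_def)
  moreover have "finite (closed_nbhd T v \<inter> B)"
    using assms(1,2) by (meson finite_Int finite_subset limited_packing_def)
  ultimately show "card (closed_nbhd T v \<inter> insert x B) \<le> Suc k"
    by (cases "x \<in> closed_nbhd T v") (auto simp: card_insert_if)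
qed (use assms in \<open>auto simp: limited_packing_def\<close>)

text \<open>Adding the vertices of a 2-limited packing by increasing depth, a new vertex \<open>y\<close> can only
  conflict with earlier vertices in the closed neighbourhood of its parent, hence with at most one.\<close>

lemma limited_packing_2_split:
  assumes T: "undirected_tree T" and B: "limited_packing 2 T B"
  obtains B1 B2 where "B = B1 \<union> B2" "limited_packing 1 T B1" "limited_packing 1 T B2"
proof -
  obtain r p d where P: "parent_structure (parcs T) (pverts T) r p d"
    using ex_parent_structure[OF T] .
  note fin = undirected_treeD(3)[OF T]
  have BV: "B \<subseteq> pverts T" using B by (simp add: limited_packing_def)
  have "finite B" using BV fin finite_subset by blast
  have "A \<subseteq> B \<longrightarrow> (\<exists>B1 B2. A = B1 \<union> B2 \<and> limited_packing 1 T B1 \<and> limited_packing 1 T B2)"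
    if "finite A" for A
    using that
  proof (induction A rule: finite_ranking_induct[where f = d])
    case empty
    then show ?case by (intro impI exI[of _ "{}"]) (simp add: limited_packing_def)
  next
    case (insert y A)
    show ?case
    proof (cases "insert y A \<subseteq> B \<and> y \<notin> A")
      case True
      then obtain A1 A2 where A: "A = A1 \<union> A2" "limited_packing 1 T A1" "limited_packing 1 T A2"
        using insert by auto
      define confl where "confl x \<longleftrightarrow> (\<exists>v\<in>pverts T. x \<in> closed_nbhd T v \<and> y \<in> closed_nbhd T v)" for x
      \<comment> \<open>Two such vertices and \<open>y\<close> would be three elements of
        \<open>B\<close> in the closed neighbourhood of \<open>p y\<close>.\<close>
      have *: "x = x'" if "x \<in> A" "x' \<in> A" "confl x" "confl x'" for x x'
      proof (rule ccontr)
        assume "x \<noteq> x'"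
        have N: "p y \<in> pverts T \<and> z \<in> closed_nbhd T (p y) \<and> y \<in> closed_nbhd T (p y)"
          if z: "z \<in> A" "confl z" for z
        proof -
          obtain v where "v \<in> pverts T" "z \<in> closed_nbhd T v" "y \<in> closed_nbhd T v"
            using z unfolding confl_def by auto
          moreover have "z \<noteq> y" "d z \<le> d y" using z True insert.hyps(2) by auto
          ultimately show ?thesis using parent_structure_key[OF P T] by blast
        qed
        have "{x, x', y} \<subseteq> closed_nbhd T (p y) \<inter> B"
          using N[OF that(1,3)] N[OF that(2,4)] that True by auto
        moreover have "x \<noteq> y" "x' \<noteq> y" using that True by auto
        then have "card {x, x', y} = 3" using \<open>x \<noteq> x'\<close> by simp
        moreover have "finite (closed_nbhd T (p y) \<inter> B)" using \<open>finite B\<close> by simp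
        ultimately have "3 \<le> card (closed_nbhd T (p y) \<inter> B)" by (metis card_mono)
        moreover have "card (closed_nbhd T (p y) \<inter> B) \<le> 2"
          using B N[OF that(1,3)] unfolding limited_packing_def by blast
        ultimately show False by simp
      qed
      have ins: "limited_packing 1 T (insert y A')" if "limited_packing 1 T A'" "\<not> (\<exists>x\<in>A'. confl x)" for A'
      proof -
        have "insert y A' \<subseteq> pverts T" using that(1) True BV by (auto simp: limited_packing_def)
        then show ?thesis using that unfolding limited_packing_1_iff[OF fin] confl_def by blast
      qed
      show ?thesis
      proof (cases "\<exists>x\<in>A1. confl x")
        case True
        show ?thesis
        proof (cases "\<exists>x\<in>A2. confl x")
          case False
          show ?thesis using ins[OF A(3) False] A by (intro impI exI[of _ A1] exI[of _ "insert y A2"]) auto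
        next
          case c2: True
          \<comment> \<open>The classes may overlap. As only one vertex of \<open>A\<close>
            conflicts with \<open>y\<close>, it lies in both classes; it is dropped from the first,
            which then admits \<open>y\<close>, and is still covered by the second.\<close>
          then obtain x where x: "x \<in> A1" "x \<in> A2" "confl x" using True * A by blast
          have "\<not> (\<exists>z\<in>A1 - {x}. confl z)" using * x A by blast
          moreover have "limited_packing 1 T (A1 - {x})"
            using A(2) unfolding limited_packing_1_iff[OF fin] by blast
          ultimately show ?thesis using ins A x
            by (intro impI exI[of _ "insert y (A1 - {x})"] exI[of _ A2]) auto
        qed
      next
        case False
        show ?thesis using ins[OF A(2) False] A by (intro impI exI[of _ "insert y A1"] exI[of _ A2]) auto
      qed
    qed (use insert in \<open>auto simp: insert_absorb\<close>)
  qed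
  then show ?thesis using that \<open>finite B\<close> by blast
qed

lemma limited_packing_number_2_le:
  assumes "undirected_tree T"
  shows "limited_packing_number 2 T \<le> 2 * limited_packing_number 1 T"
proof -
  note fin = undirected_treeD(3)[OF assms]
  obtain B where B: "limited_packing 2 T B" "card B = limited_packing_number 2 T"
    using ex_maximum_limited_packing[OF fin] .
  obtain B1 B2 where S: "B = B1 \<union> B2" "limited_packing 1 T B1" "limited_packing 1 T B2"
    using limited_packing_2_split[OF assms B(1)] .
  have "card B \<le> card B1 + card B2" using S(1) by (simp add: card_Un_le)
  then show ?thesis using limited_packing_le[OF fin S(2)] limited_packing_le[OF fin S(3)] B(2) by simp
qed

lemma tree_ex_neighbour:
  assumes "undirected_tree T" "u \<in> pverts T"
  obtains v where "(u, v) \<in> parcs T"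
proof -
  note T = undirected_treeD[OF assms(1)]
  have "\<not> pverts T \<subseteq> {u}" using T(2) card_mono[of "{u}" "pverts T"] by auto
  then obtain w where "w \<in> pverts T" "w \<noteq> u" by auto
  then show ?thesis using T(8)[OF assms(2)] that by (metis converse_rtranclE)
qed

text \<open>The ends of an arc share a closed neighbourhood, so at most one of them is in
  \<open>B\<close>. This supplies the extra vertex for a 2-limited packing.\<close>

lemma limited_packing_1_psubset:
  assumes "undirected_tree T" "limited_packing 1 T B"
  shows "B \<subset> pverts T"
proof -
  note T = undirected_treeD[OF assms(1)]
  obtain u where u: "u \<in> pverts T" using T(2) by fastforce
  obtain v where v: "(u, v) \<in> parcs T" using tree_ex_neighbour[OF assms(1) u] .
  have "u \<notin> B \<or> v \<notin> B"
    using assms(2) u v T(7) unfolding limited_packing_1_iff[OF T(3)] closed_nbhd_def by fastforce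
  then show ?thesis using assms(2) u v T(5) unfolding limited_packing_def by blast
qed

lemma limited_packing_number_1_less:
  assumes "undirected_tree T"
  shows "limited_packing_number 1 T + 1 \<le> limited_packing_number 2 T"
proof -
  note fin = undirected_treeD(3)[OF assms]
  obtain B where B: "limited_packing 1 T B" "card B = limited_packing_number 1 T"
    using ex_maximum_limited_packing[OF fin] .
  then obtain x where "x \<in> pverts T" "x \<notin> B" "finite B"
    using limited_packing_1_psubset[OF assms] fin by (meson finite_subset psubset_imp_ex_mem psubsetE DiffE)
  then show ?thesis
    using limited_packing_le[OF fin limited_packing_insert[OF fin B(1), of x]] B(2)
    by (simp add: numeral_2_eq_2)
qed

text \<open>Helly property of the closed neighbourhoods: the parent of a deepest vertex of \<open>A\<close> works.\<close>

lemma tree_helly: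
  assumes T: "undirected_tree T" and A: "A \<subseteq> pverts T" "A \<noteq> {}"
    and conn: "\<And>x y. x \<in> A \<Longrightarrow> y \<in> A \<Longrightarrow> x \<noteq> y \<Longrightarrow>
      \<exists>v\<in>pverts T. x \<in> closed_nbhd T v \<and> y \<in> closed_nbhd T v"
  obtains c where "c \<in> pverts T" "A \<subseteq> closed_nbhd T c"
proof -
  obtain r p d where P: "parent_structure (parcs T) (pverts T) r p d"
    using ex_parent_structure[OF T] .
  have "finite A" using A undirected_treeD(3)[OF T] finite_subset by blast
  then have "Max (d ` A) \<in> d ` A" using A(2) by simp
  then obtain y where y: "y \<in> A" "d y = Max (d ` A)" by auto
  have max: "d x \<le> d y" if "x \<in> A" for x
    using that y(2) \<open>finite A\<close> by simp
  show ?thesis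
  proof (cases "A = {y}")
    \<comment> \<open>Here \<open>y\<close> may be the root, where \<open>p y\<close> carries no
      information, so \<open>y\<close> itself is the centre.\<close>
    case True
    then show ?thesis using A that[of y] by (simp add: closed_nbhd_def)
  next
    case False
    have key: "p y \<in> pverts T \<and> x \<in> closed_nbhd T (p y) \<and> y \<in> closed_nbhd T (p y)"
      if "x \<in> A" "x \<noteq> y" for x
      using conn[OF that(1) y(1) that(2)] parent_structure_key[OF P T] max[OF that(1)] that(2) by blast
    obtain x where "x \<in> A" "x \<noteq> y" using False y(1) by auto
    then show ?thesis using that[of "p y"] key by blast
  qed
qed

section \<open>Spiders\<close>

text \<open>A pair \<open>(a, w) \<in> L\<close> says that \<open>w\<close> subdivides the edge \<open>ca\<close> of the star with centre \<open>c\<close>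
  and leaves \<open>X\<close>.\<close>

definition spider_graph :: "'a \<Rightarrow> 'a set \<Rightarrow> ('a \<times> 'a) set \<Rightarrow> 'a pair_pre_digraph" where
  "spider_graph c X L = \<lparr> pverts = insert c X \<union> snd ` L,
     parcs = {(u, v). u = c \<and> v \<in> X - fst ` L \<or> v = c \<and> u \<in> X - fst ` L \<or>
       u = c \<and> v \<in> snd ` L \<or> v = c \<and> u \<in> snd ` L \<or> (u, v) \<in> L \<or> (v, u) \<in> L} \<rparr>"

lemma spider_graph_simps:
  "pverts (spider_graph c X L) = insert c X \<union> snd ` L"
  "(u, v) \<in> parcs (spider_graph c X L) \<longleftrightarrow> u = c \<and> v \<in> X - fst ` L \<or> v = c \<and> u \<in> X - fst ` L \<or>
       u = c \<and> v \<in> snd ` L \<or> v = c \<and> u \<in> snd ` L \<or> (u, v) \<in> L \<or> (v, u) \<in> L"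
  by (simp_all add: spider_graph_def)

text \<open>Injectivity of \<open>fst\<close> on \<open>L\<close> forbids subdividing an edge twice;
  injectivity of \<open>snd\<close> keeps the new vertices distinct.\<close>

definition spider_data :: "'a \<Rightarrow> 'a set \<Rightarrow> ('a \<times> 'a) set \<Rightarrow> bool" where
  "spider_data c X L \<longleftrightarrow> finite X \<and> X \<noteq> {} \<and> c \<notin> X \<and> finite L \<and> inj_on fst L \<and> inj_on snd L \<and>
     fst ` L \<subseteq> X \<and> snd ` L \<inter> insert c X = {}"

section \<open>Stars and distances\<close>

lemma (in wf_digraph) unit_awalk_cost: "awalk_cost (\<lambda>_. 1) p = real (length p)"
  by (induction p) auto

lemma diameter_le_2_iff:
  assumes "pair_wf_digraph G"
  shows "diameter G \<le> 2 \<longleftrightarrow> (\<forall>u\<in>pverts G. \<forall>v\<in>pverts G. u = v \<or> (u, v) \<in> parcs G \<or>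
    (\<exists>w. (u, w) \<in> parcs G \<and> (w, v) \<in> parcs G))"
proof -
  interpret pair_wf_digraph G by fact
  have "\<mu> (\<lambda>_. 1) u v \<le> 2 \<longleftrightarrow> u = v \<or> (u, v) \<in> parcs G \<or> (\<exists>w. (u, w) \<in> parcs G \<and> (w, v) \<in> parcs G)"
    (is "_ \<longleftrightarrow> ?near") if uv: "u \<in> pverts G" "v \<in> pverts G" for u v
  proof
    assume le: "\<mu> (\<lambda>_. 1) u v \<le> 2"
    have "\<exists>p. awalk u p v \<and> length p \<le> 2"
    proof (rule ccontr)
      assume *: "\<not> ?thesis"
      \<comment> \<open>Costs are integers, so if none is at most 2 the infimum is at least 3; this
        includes the case of no walk at all.\<close>
      have "3 \<le> \<mu> (\<lambda>_. 1) u v" unfolding \<mu>_def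
      proof (rule INF_greatest)
        fix p assume "p \<in> {p. awalk u p v}"
        then have "3 \<le> real (length p)" using * by force
        then show "3 \<le> ereal (awalk_cost (\<lambda>_. 1) p)" unfolding unit_awalk_cost
          by (metis ereal_less_eq(3) numeral_eq_ereal)
      qed
      then have "(3::ereal) \<le> 2" using le by (rule order_trans)
      then show False by simp
    qed
    then obtain p where p: "awalk u p v" "length p \<le> 2" by auto
    consider "p = []" | e where "p = [e]" | e f where "p = [e, f]"
      using p(2) by (cases p rule: remdups_adj.cases) auto
    then show ?near using p(1) by cases (auto simp: awalk_simps)
  next
    assume ?near
    then consider "u = v" | "(u, v) \<in> parcs G" | w where "(u, w) \<in> parcs G" "(w, v) \<in> parcs G" by auto
    then obtain p where p: "awalk u p v" "length p \<le> 2"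
    proof cases
      case 1
      then show ?thesis using that[of "[]"] uv by (simp add: awalk_simps)
    next
      case 2
      then show ?thesis using that[of "[(u, v)]"] uv by (simp add: awalk_simps)
    next
      case 3
      then show ?thesis using that[of "[(u, w), (w, v)]"] uv by (simp add: awalk_simps)
    qed
    have "\<mu> (\<lambda>_. 1) u v \<le> ereal (real (length p))"
      using min_cost_le_walk_cost[OF p(1), of "\<lambda>_. 1"] unfolding unit_awalk_cost .
    also have "\<dots> \<le> 2" using p(2) by (metis ereal_less_eq(3) numeral_eq_ereal of_nat_le_iff of_nat_numeral)
    finally show "\<mu> (\<lambda>_. 1) u v \<le> 2" .
  qed
  then show ?thesis unfolding diameter_def SUP_le_iff by blast
qed

text \<open>With diameter at most 2, any two vertices share a closed neighbourhood, so the Helly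
  property yields a centre adjacent to all others. An arc avoiding the centre would complete a
  triangle.\<close>

lemma star_imp_spider_graph:
  assumes "star S"
  obtains c X where "spider_data c X {}" "S = spider_graph c X {}"
proof -
  have S: "undirected_tree S" "diameter S \<le> 2" using assms by (auto simp: star_def)
  note T = undirected_treeD[OF S(1)]
  interpret pair_graph S by (rule T(1))
  have near: "u = v \<or> (u, v) \<in> parcs S \<or> (\<exists>w. (u, w) \<in> parcs S \<and> (w, v) \<in> parcs S)"
    if "u \<in> pverts S" "v \<in> pverts S" for u v
    using S(2) that unfolding diameter_le_2_iff[OF pair_wf_digraph] by blast
  obtain c where c: "c \<in> pverts S" "pverts S \<subseteq> closed_nbhd S c"
  proof (rule tree_helly[OF S(1), of "pverts S"])
    show "pverts S \<noteq> {}" using T(2) by auto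
    show "\<exists>v\<in>pverts S. x \<in> closed_nbhd S v \<and> y \<in> closed_nbhd S v"
      if "x \<in> pverts S" "y \<in> pverts S" "x \<noteq> y" for x y
      using near[OF that(1,2)] that T(4,5,6) unfolding closed_nbhd_def by blast
  qed auto
  let ?X = "pverts S - {c}"
  have adj: "(c, x) \<in> parcs S" if "x \<in> ?X" for x using that c(2) by (auto simp: closed_nbhd_def)
  have "\<not> pverts S \<subseteq> {c}" using T(2) card_mono[of "{c}" "pverts S"] by auto
  then have "spider_data c ?X {}" using T(3) by (auto simp: spider_data_def)
  moreover have "S = spider_graph c ?X {}"
  proof -
    have "parcs S = {(u, v). u = c \<and> v \<in> ?X \<or> v = c \<and> u \<in> ?X}"
    proof (rule set_eqI, clarify)
      fix u v
      show "(u, v) \<in> parcs S \<longleftrightarrow> (u, v) \<in> {(u, v). u = c \<and> v \<in> ?X \<or> v = c \<and> u \<in> ?X}"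
      proof
        assume uv: "(u, v) \<in> parcs S"
        show "(u, v) \<in> {(u, v). u = c \<and> v \<in> ?X \<or> v = c \<and> u \<in> ?X}"
        proof (cases "u = c \<or> v = c")
          case True
          then show ?thesis using uv T(4,5,7) by auto
        next
          case False
          then show ?thesis using tree_no_triangle[OF S(1) adj uv adj] T(4,5)[OF uv] by simp
        qed
      qed (use adj T(6) in auto)
    qed
    then show ?thesis unfolding spider_graph_def using c(1) by (intro pair_pre_digraph.equality) auto
  qed
  ultimately show ?thesis using that by blast
qed

lemma star_spider_graph:
  assumes "spider_data c X {}"
  shows "star (spider_graph c X {})"
proof -
  let ?S = "spider_graph c X {}"
  have X: "finite X" "X \<noteq> {}" "c \<notin> X" using assms by (auto simp: spider_data_def)
  have S: "pverts ?S = insert c X" "parcs ?S = {(u, v). u = c \<and> v \<in> X \<or> v = c \<and> u \<in> X}"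
    by (auto simp: spider_graph_def)
  have "parcs ?S \<subseteq> insert c X \<times> insert c X" unfolding S by auto
  then have fin: "finite (parcs ?S)" by (rule finite_subset) (use X in auto)
  interpret pair_graph ?S
    by unfold_locales (use X fin in \<open>auto simp: S symmetric_def sym_def\<close>)
  have "1 \<le> card X" using X by (simp add: Suc_leI card_gt_0_iff)
  then have "2 \<le> card (pverts ?S)" using X unfolding S by simp
  then have nt: "nontrivial_graph ?S" unfolding nontrivial_graph_def by auto
  have mk: "mk_symmetric (with_proj ?S) = ?S"
    unfolding mk_symmetric_def by (intro pair_pre_digraph.equality) (auto simp: S)
  have reach_c: "u \<rightarrow>\<^sup>*\<^bsub>with_proj ?S\<^esub> c \<and> c \<rightarrow>\<^sup>*\<^bsub>with_proj ?S\<^esub> u" if "u \<in> pverts ?S" for u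
  proof (cases "u = c")
    case True
    then show ?thesis using that by auto
  next
    case False
    then have "(u, c) \<in> parcs ?S" "(c, u) \<in> parcs ?S" using that by (auto simp: S)
    then show ?thesis using reachable_adjI by simp
  qed
  have conn: "Digraph_Component.connected (with_proj ?S)"
    unfolding Digraph_Component.connected_def mk
  proof (rule strongly_connectedI)
    show "u \<rightarrow>\<^sup>*\<^bsub>with_proj ?S\<^esub> v" if "u \<in> verts (with_proj ?S)" "v \<in> verts (with_proj ?S)" for u v
      using that reach_c reachable_trans by (metis with_proj_simps(1))
  qed (simp add: S)
  \<comment> \<open>Every second vertex of a walk is \<open>c\<close>: a closed walk cannot have
    three arcs, and one with four or more repeats \<open>c\<close>.\<close>
  have acyc: "length p < 3" if cyc: "cycle p" for p
  proof (rule ccontr)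
    assume len: "\<not> length p < 3"
    obtain u where u: "awalk u p u" "distinct (tl (awalk_verts u p))" using cyc by (auto simp: cycle_def)
    obtain e1 e2 e3 q where p: "p = e1 # e2 # e3 # q"
      using len by (metis One_nat_def Suc_1 length_Cons less_Suc_eq list.exhaust list.size(3) numeral_3_eq_3 zero_less_Suc)
    show False
    proof (cases q)
      case Nil
      then show ?thesis using u p X(3) by (auto simp: awalk_simps S)
    next
      case (Cons e4 q')
      then show ?thesis using u p X(3) by (cases q') (auto simp: awalk_simps S)
    qed
  qed
  have tree: "undirected_tree ?S" unfolding undirected_tree_def using nt conn acyc not_le by blast
  have "diameter ?S \<le> 2" unfolding diameter_le_2_iff[OF pair_wf_digraph] S using X by auto
  then show ?thesis using tree by (simp add: star_def)
qed

section \<open>Spiders in explicit form\<close>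

lemma subdivide_swap: "subdivide G (v, u) w = subdivide G (u, v) w"
  by (intro pair_pre_digraph.equality) auto

lemma subdivide_spider_graph:
  assumes "c \<notin> X" "a \<in> X - fst ` L" "fst ` L \<subseteq> X" "snd ` L \<inter> insert c X = {}" "e = (c, a) \<or> e = (a, c)"
  shows "subdivide (spider_graph c X L) e w = spider_graph c X (insert (a, w) L)"
proof -
  have L: "(c, x) \<notin> L" "(x, c) \<notin> L" "(x, a) \<notin> L" "c \<notin> snd ` L" "a \<notin> snd ` L" "(a, x) \<notin> L" for x
    using assms(1-4) by force+
  have ac: "a \<noteq> c" "c \<noteq> a" "a \<in> X" "c \<notin> X" "a \<notin> fst ` L" using assms by auto
  have "subdivide (spider_graph c X L) e w = subdivide (spider_graph c X L) (c, a) w"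
    using assms(5) subdivide_swap by metis
  moreover have "((u, v) \<in> parcs (subdivide (spider_graph c X L) (c, a) w)) =
    ((u, v) \<in> parcs (spider_graph c X (insert (a, w) L)))" for u v
    unfolding arcs_subdivide Un_iff Diff_iff insert_iff empty_iff spider_graph_simps image_insert fst_conv snd_conv prod.inject
    by (cases "u = c"; cases "v = c"; cases "u = a"; cases "v = a") (simp_all add: L ac disj_ac)
  ultimately have "parcs (subdivide (spider_graph c X L) e w) = parcs (spider_graph c X (insert (a, w) L))"
    by (metis subrelI subset_antisym)
  moreover have "pverts (subdivide (spider_graph c X L) e w) = pverts (spider_graph c X (insert (a, w) L))"
    by (simp add: spider_graph_simps)
  ultimately show ?thesis by (intro pair_pre_digraph.equality) simp_all
qed


text \<open>\<open>as\<close> lists the leaf ends of the edges \<open>es\<close>, whose arcs may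
  point either way; \<open>L\<close> accumulates the subdivisions already made and so is generalized
  in the induction.\<close>

lemma fold_subdivide_spider_graph:
  assumes "length as = length ws" "c \<notin> X" "fst ` L \<subseteq> X" "snd ` L \<inter> insert c X = {}"
    and "list_all2 (\<lambda>e a. e = (c, a) \<or> e = (a, c)) es as"
    and "distinct as" "set as \<subseteq> X - fst ` L" "set ws \<inter> insert c X = {}"
  shows "fold (\<lambda>(e, w) G. subdivide G e w) (zip es ws) (spider_graph c X L) =
    spider_graph c X (set (zip as ws) \<union> L)"
  using assms
proof (induction as ws arbitrary: es L rule: list_induct2)
  case (Cons a as w ws)
  then obtain e es' where es: "es = e # es'" "e = (c, a) \<or> e = (a, c)"
    "list_all2 (\<lambda>e a. e = (c, a) \<or> e = (a, c)) es' as"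
    by (auto simp: list_all2_Cons2)
  have sub: "subdivide (spider_graph c X L) e w = spider_graph c X (insert (a, w) L)"
    using Cons.prems es(2) by (intro subdivide_spider_graph) auto
  have "fold (\<lambda>(e, w) G. subdivide G e w) (zip es' ws) (spider_graph c X (insert (a, w) L)) =
    spider_graph c X (set (zip as ws) \<union> insert (a, w) L)"
    by (rule Cons.IH) (use Cons.prems es in auto)
  then show ?case by (simp add: es(1) sub)
qed simp

text \<open>Trades iterated subdivision for a graph in which adjacency can be read off.\<close>

lemma spider_iff:
  "spider t T \<longleftrightarrow> (\<exists>c X L. spider_data c X L \<and> card L = t \<and> T = spider_graph c X L)"
proof
  assume "spider t T"
  then obtain S es ws where S: "star S" and es: "length es = t" "set es \<subseteq> parcs S"
      "distinct (map (\<lambda>(u, v). {u, v}) es)"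
    and ws: "length ws = t" "set ws \<inter> pverts S = {}" "distinct ws"
    and T: "T = fold (\<lambda>(e, w) G. subdivide G e w) (zip es ws) S"
    unfolding spider_def by blast
  obtain c X where X: "spider_data c X {}" "S = spider_graph c X {}"
    using star_imp_spider_graph[OF S] .
  \<comment> \<open>The end of \<open>e\<close> other than the centre. Since the undirected edge is
    \<open>{c, leaf e}\<close>, distinct edges have distinct leaves.\<close>
  define leaf where "leaf e = (if fst e = c then snd e else fst e)" for e
  let ?as = "map leaf es"
  have c: "c \<notin> X" using X(1) by (simp add: spider_data_def)
  have leaf: "leaf e \<in> X \<and> (e = (c, leaf e) \<or> e = (leaf e, c))" if "e \<in> set es" for e
  proof -
    have "e \<in> parcs S" using es(2) that by blast
    then show ?thesis using c by (cases e) (auto simp: leaf_def X(2) spider_graph_simps)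
  qed
  have edge: "(\<lambda>(u, v). {u, v}) e = {c, leaf e}" if "e \<in> set es" for e
  proof -
    obtain u v where "e = (u, v)" by fastforce
    then show ?thesis using leaf[OF that] by (auto simp: insert_commute)
  qed
  have "inj_on leaf (set es)"
  proof (rule inj_onI)
    fix e f assume "e \<in> set es" "f \<in> set es" "leaf e = leaf f"
    then show "e = f" using es(3) edge unfolding distinct_map inj_on_def by metis
  qed
  then have das: "distinct ?as" using es(3) by (simp add: distinct_map)
  let ?L = "set (zip ?as ws)"
  have len: "length ?as = length ws" using es(1) ws(1) by simp
  have fst: "fst ` ?L = set ?as" and snd: "snd ` ?L = set ws"
    using len by (metis set_map map_fst_zip, metis set_map map_snd_zip)
  have ws': "set ws \<inter> insert c X = {}" using ws(2) by (simp add: X(2) spider_graph_simps)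
  have "T = spider_graph c X (?L \<union> {})" unfolding T X(2)
    by (rule fold_subdivide_spider_graph)
      (use len c das leaf ws' in \<open>auto simp: list_all2_conv_all_nth\<close>)
  moreover have "inj_on fst ?L" "inj_on snd ?L"
    using das ws(3) len by (metis distinct_map map_fst_zip, metis distinct_map map_snd_zip)
  then have "spider_data c X ?L"
    using X(1) leaf ws' unfolding spider_data_def fst snd by auto
  moreover have "card ?L = t" using distinct_card[OF distinct_zipI1[OF das], of ws] es(1) ws(1) by simp
  ultimately show "\<exists>c X L. spider_data c X L \<and> card L = t \<and> T = spider_graph c X L" by auto
next
  assume "\<exists>c X L. spider_data c X L \<and> card L = t \<and> T = spider_graph c X L"
  then obtain c X L where L: "spider_data c X L" "card L = t" and T: "T = spider_graph c X L" by blast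
  have "finite L" using L(1) by (simp add: spider_data_def)
  then obtain xs where xs: "set xs = L" "distinct xs" using finite_distinct_list by blast
  \<comment> \<open>An enumeration of \<open>L\<close> prescribes the order in which the star edges
    are subdivided.\<close>
  let ?es = "map (\<lambda>(a, w). (c, a)) xs" and ?as = "map fst xs" and ?ws = "map snd xs"
  have as: "distinct ?as" "distinct ?ws" "set ?as \<subseteq> X" "set ?ws \<inter> insert c X = {}"
    using L(1) xs by (auto simp: spider_data_def distinct_map)
  have X: "spider_data c X {}" "c \<notin> X" using L(1) by (auto simp: spider_data_def)
  have "T = fold (\<lambda>(e, w) G. subdivide G e w) (zip ?es ?ws) (spider_graph c X {})"
    unfolding T xs(1)[symmetric]
    by (subst fold_subdivide_spider_graph[where as = ?as])
      (use as X in \<open>auto simp: list_all2_conv_all_nth zip_map_fst_snd split: prod.splits\<close>)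
  moreover have "set ?es \<subseteq> parcs (spider_graph c X {})"
    using as(3) by (auto simp: spider_graph_simps)
  moreover have "distinct (map (\<lambda>(u, v). {u, v}) ?es)"
  proof -
    have "map (\<lambda>(u, v). {u, v}) ?es = map (\<lambda>a. {c, a}) ?as" by auto
    moreover have "inj_on (\<lambda>a. {c, a}) (set ?as)" by (auto intro!: inj_onI simp: doubleton_eq_iff)
    ultimately show ?thesis using as(1) by (simp add: distinct_map del: map_map)
  qed
  moreover have "set ?ws \<inter> pverts (spider_graph c X {}) = {}" using as(4) by (simp add: spider_graph_simps)
  moreover have "length xs = t" using L(2) xs distinct_card by metis
  ultimately show "spider t T"
    unfolding spider_def using star_spider_graph[OF X(1)] as(2)
    by (intro exI[of _ "spider_graph c X {}"] exI[of _ ?es] exI[of _ ?ws]) simp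
qed

section \<open>Packing numbers of a spider\<close>

lemma out_degree_pair: "out_degree (with_proj G) v = card {u. (v, u) \<in> parcs G}"
proof -
  have "out_arcs (with_proj G) v = Pair v ` {u. (v, u) \<in> parcs G}" by (auto simp: out_arcs_def)
  then show ?thesis by (simp add: out_degree_def card_image inj_on_def)
qed

lemma spider_packing_numbers:
  assumes L: "spider_data c X L" and T: "T = spider_graph c X L"
    and "card L < max_degree T"
  shows "limited_packing_number 2 T \<le> limited_packing_number 1 T + 1"
proof -
  have fX: "finite X" "X \<noteq> {}" "c \<notin> X" and fL: "finite L" "inj_on fst L" "inj_on snd L"
    and sub: "fst ` L \<subseteq> X" "snd ` L \<inter> insert c X = {}"
    using L by (auto simp: spider_data_def)
  have verts: "pverts T = insert c X \<union> snd ` L" by (simp add: T spider_graph_simps)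
  have fin: "finite (pverts T)" using fX fL by (simp add: verts)
  have cards: "card (fst ` L) = card L" "card (snd ` L) = card L" using fL by (simp_all add: card_image)
  have arc: "(u, v) \<in> parcs T \<longleftrightarrow> u = c \<and> v \<in> X - fst ` L \<or> v = c \<and> u \<in> X - fst ` L \<or>
       u = c \<and> v \<in> snd ` L \<or> v = c \<and> u \<in> snd ` L \<or> (u, v) \<in> L \<or> (v, u) \<in> L" for u v
    unfolding T spider_graph_simps ..
  have le: "card L \<le> card X" using card_mono[OF fX(1) sub(1)] cards(1) by simp
  show ?thesis
  proof (cases "card L < card X")
    case True
    then obtain x where x: "x \<in> X" "x \<notin> fst ` L" using cards(1) sub(1) by (metis order_less_irrefl subsetI subset_antisym)
    have "limited_packing 1 T (insert x (fst ` L))"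
      unfolding limited_packing_1_iff[OF fin]
    proof (intro conjI ballI)
      show "insert x (fst ` L) \<subseteq> pverts T" using x sub by (auto simp: verts)
      have fstD: "a = a'" if "(a, w) \<in> L" "(a', w) \<in> L" for a a' w
        using that fL(3) by (metis inj_onD prod.inject snd_conv)
      \<comment> \<open>The three alternatives exclude each other by the position of
        \<open>v\<close>, and each determines \<open>y\<close> from \<open>v\<close>.\<close>
      have nb: "v \<in> {c, x} \<and> y = x \<or> v \<notin> insert c X \<and> (y, v) \<in> L \<or> v \<in> fst ` L \<and> y = v"
        if "y \<in> closed_nbhd T v \<inter> insert x (fst ` L)" for y v
      proof -
        have y: "y = v \<or> (v, y) \<in> parcs T" "y = x \<or> y \<in> fst ` L"
          using that by (auto simp: closed_nbhd_def)
        have "y \<in> X" using y(2) x sub(1) by auto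
        then have "y \<noteq> c" "y \<notin> snd ` L" using sub(2) fX(3) by auto
        then have "y = v \<or> v = c \<and> y \<notin> fst ` L \<or> (y, v) \<in> L"
          using y(1) unfolding arc by (auto simp: image_iff)
        moreover have "v \<notin> insert c X" if "(y, v) \<in> L" using that sub(2) by force
        ultimately show ?thesis using y(2) by blast
      qed
      have "x \<in> insert c X" "fst ` L \<subseteq> X" "c \<notin> fst ` L" using x sub fX(3) by auto
      note excl = this x(2)
      fix v y z assume "y \<in> closed_nbhd T v \<inter> insert x (fst ` L)" "z \<in> closed_nbhd T v \<inter> insert x (fst ` L)"
      from nb[OF this(1)] nb[OF this(2)] show "y = z"
        using fstD excl by blast
    qed
    moreover have "card (insert x (fst ` L)) = card L + 1" using x fL cards by simp
    ultimately have 1: "card L + 1 \<le> limited_packing_number 1 T" using limited_packing_le[OF fin] by metis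
    obtain B where B: "limited_packing 2 T B" "card B = limited_packing_number 2 T"
      using ex_maximum_limited_packing[OF fin] .
    have BV: "B \<subseteq> pverts T" "c \<in> pverts T" using B(1) by (auto simp: limited_packing_def verts)
    then have "B \<subseteq> fst ` L \<union> (closed_nbhd T c \<inter> B)"
      by (auto simp: closed_nbhd_def arc verts)
    then have "card B \<le> card (fst ` L \<union> (closed_nbhd T c \<inter> B))"
      using fL BV fin by (meson card_mono finite_Int finite_UnI finite_imageI finite_subset)
    also have "\<dots> \<le> card L + card (closed_nbhd T c \<inter> B)" using card_Un_le cards(1) by metis
    also have "\<dots> \<le> card L + 2" using B(1) BV(2) by (simp add: limited_packing_def)
    finally show ?thesis using B(2) 1 by simp
  next
    case False
    then have X: "fst ` L = X" "card L = card X" using le cards(1) sub(1) fX(1) by (auto simp: card_subset_eq)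
    have "max_degree T \<in> out_degree (with_proj T) ` pverts T"
      unfolding max_degree_def using fin by (intro Max_in) (auto simp: verts)
    then obtain v where v: "v \<in> pverts T" "card L < card {u. (v, u) \<in> parcs T}"
      using assms(3) by (auto simp: out_degree_pair)
    have "card L \<noteq> 0" using X fX by simp
    \<comment> \<open>The degree of \<open>v\<close> exceeds \<open>card L\<close>, but the centre
      has degree \<open>card L\<close> and a far leaf has degree 1. A subdividing vertex has degree
      at most 2, which will force \<open>card L = 1\<close>.\<close>
    have "v \<in> snd ` L"
    proof (rule ccontr)
      assume nv: "v \<notin> snd ` L"
      show False
      proof (cases "v = c")
        case True
        have "(c, u) \<notin> L" "(u, c) \<notin> L" for u using sub fX(3) by force+
        then have "{u. (v, u) \<in> parcs T} = snd ` L"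
          unfolding True arc X(1) using sub(2) by auto
        then show False using v(2) cards(2) by simp
      next
        case nc: False
        obtain w where w: "(v, w) \<in> L" using v(1) nv nc X(1) by (auto simp: verts)
        have "u = w" if "(v, u) \<in> L" for u using that w fL(2) by (metis inj_onD fst_conv prod.inject)
        moreover have "(u, v) \<notin> L" for u using nv by force
        ultimately have "{u. (v, u) \<in> parcs T} \<subseteq> {w}" unfolding arc X(1) using nv nc by blast
        then have "card {u. (v, u) \<in> parcs T} \<le> 1" using card_mono[of "{w}"] by fastforce
        then show False using v(2) \<open>card L \<noteq> 0\<close> by simp
      qed
    qed
    then obtain a where a: "(a, v) \<in> L" by auto
    have "u = a" if "(u, v) \<in> L" for u using that a fL(3) by (metis inj_onD snd_conv prod.inject)
    moreover have "v \<noteq> c" "v \<notin> X" using sub(2) a by force+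
    moreover from this have "(v, u) \<notin> L" for u using sub(1) by force
    ultimately have "{u. (v, u) \<in> parcs T} \<subseteq> {c, a}" unfolding arc X(1) by blast
    then have "card {u. (v, u) \<in> parcs T} \<le> card {c, a}" by (intro card_mono) auto
    also have "\<dots> \<le> 2" by (simp add: card_insert_if)
    finally have "card {u. (v, u) \<in> parcs T} \<le> 2" .
    then have "card L = 1" using v(2) \<open>card L \<noteq> 0\<close> by simp
    then have L1: "L = {(a, v)}" using a by (metis card_1_singletonE singletonD)
    then have "X = {a}" using X(1) by simp
    then have N: "pverts T \<subseteq> closed_nbhd T v" by (auto simp: closed_nbhd_def arc L1 verts)
    obtain B where B: "limited_packing 2 T B" "card B = limited_packing_number 2 T"
      using ex_maximum_limited_packing[OF fin] .
    then have "closed_nbhd T v \<inter> B = B" using N by (auto simp: limited_packing_def)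
    then have "card B \<le> 2" using B(1) v(1) unfolding limited_packing_def by metis
    \<comment> \<open>Adding \<open>v\<close> to the empty 0-limited packing gives a 1-limited
      packing of size 1.\<close>
    moreover have "limited_packing 0 T {}" by (simp add: limited_packing_def)
    then have "1 \<le> limited_packing_number 1 T"
      using limited_packing_le[OF fin limited_packing_insert[OF fin _ v(1)], of 0 "{}"] by simp
    ultimately show ?thesis using B(2) by simp
  qed
qed

section \<open>Trees with a tight packing\<close>

lemma spider_data_of_tree:
  assumes T: "undirected_tree T" and c: "c \<in> pverts T"
    and Y: "Y = pverts T - closed_nbhd T c"
    and f: "\<And>a. a \<in> Y \<Longrightarrow> (c, f a) \<in> parcs T" "\<And>a w. a \<in> Y \<Longrightarrow> (a, w) \<in> parcs T \<longleftrightarrow> w = f a"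
    and inj: "inj_on f Y"
  shows "spider_data c (pverts T - {c} - f ` Y) ((\<lambda>a. (a, f a)) ` Y)"
    and "T = spider_graph c (pverts T - {c} - f ` Y) ((\<lambda>a. (a, f a)) ` Y)"
proof -
  note D = undirected_treeD[OF T]
  let ?X = "pverts T - {c} - f ` Y" and ?L = "(\<lambda>a. (a, f a)) ` Y"
  have fY: "finite Y" using Y D(3) by simp
  have fst: "fst ` ?L = Y" and snd: "snd ` ?L = f ` Y" by (force simp: image_image)+
  have fX: "f a \<in> pverts T" "f a \<noteq> c" "f a \<notin> Y" if "a \<in> Y" for a
    using f(1)[OF that] D(5,7) Y by (auto simp: closed_nbhd_def)
  have YX: "Y \<subseteq> ?X" using fX Y by (auto simp: closed_nbhd_def)
  have "?X \<noteq> {}"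
  proof (cases "Y = {}")
    case True
    have "\<not> pverts T \<subseteq> {c}" using D(2) card_mono[of "{c}" "pverts T"] by auto
    then show ?thesis using True by auto
  qed (use YX in auto)
  then show "spider_data c ?X ?L"
    unfolding spider_data_def fst snd using YX fY D(3) inj fX(2)
    by (auto simp: inj_on_def)
  have arc: "(u, v) \<in> parcs T \<longleftrightarrow> (u, v) \<in> parcs (spider_graph c ?X ?L)" for u v
  proof
    assume uv: "(u, v) \<in> parcs T"
    then have V: "u \<in> pverts T" "v \<in> pverts T" "(v, u) \<in> parcs T" "u \<noteq> v" using D(4-7) by blast+
    consider "u \<in> Y" | "v \<in> Y" | "u = c" "v \<notin> Y" | "v = c" "u \<notin> Y"
      | "(c, u) \<in> parcs T" "(c, v) \<in> parcs T"
      using V Y by (auto simp: closed_nbhd_def)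
    then show "(u, v) \<in> parcs (spider_graph c ?X ?L)"
    proof cases
      case 1
      then show ?thesis using uv f(2) unfolding spider_graph_simps by auto
    next
      case 2
      then show ?thesis using V(3) f(2) unfolding spider_graph_simps by auto
    next
      case 3
      then show ?thesis using V unfolding spider_graph_simps fst snd by auto
    next
      case 4
      then show ?thesis using V unfolding spider_graph_simps fst snd by auto
    next
      case 5
      then show ?thesis using tree_no_triangle[OF T _ uv] by blast
    qed
  next
    assume "(u, v) \<in> parcs (spider_graph c ?X ?L)"
    moreover have "(c, x) \<in> parcs T" if "x \<in> ?X - Y" for x using that Y by (auto simp: closed_nbhd_def)
    ultimately show "(u, v) \<in> parcs T"
      using f D(6) unfolding spider_graph_simps fst snd by blast
  qed
  have "pverts T = pverts (spider_graph c ?X ?L)"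
    unfolding spider_graph_simps snd using c fX by auto
  moreover have "parcs T = parcs (spider_graph c ?X ?L)" by (rule subset_antisym; rule subrelI; use arc in blast)
  ultimately show "T = spider_graph c ?X ?L" by (intro pair_pre_digraph.equality) simp_all
qed

lemma tight_packing_imp_spider:
  assumes T: "undirected_tree T" and eq: "limited_packing_number 1 T + 1 = limited_packing_number 2 T"
  shows "\<exists>t < max_degree T. spider t T"
proof -
  note D = undirected_treeD[OF T]
  obtain B where B: "limited_packing 1 T B" "card B = limited_packing_number 1 T"
    using ex_maximum_limited_packing[OF D(3)] .
  have BV: "B \<subset> pverts T" using limited_packing_1_psubset[OF T B(1)] .
  then have fB: "finite B" using D(3) finite_subset by blast
  have uniq: "x = y" if "v \<in> pverts T" "x \<in> closed_nbhd T v" "y \<in> closed_nbhd T v" "x \<in> B" "y \<in> B" for v x y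
    using B(1) that unfolding limited_packing_1_iff[OF D(3)] by blast
  \<comment> \<open>That the neighbourhood meets \<open>B\<close> is irrelevant for finding the
    centre but decides the degree bound at the end.\<close>
  have conn: "\<exists>v\<in>pverts T. x \<in> closed_nbhd T v \<and> y \<in> closed_nbhd T v \<and> closed_nbhd T v \<inter> B \<noteq> {}"
    if xy: "x \<in> pverts T - B" "y \<in> pverts T - B" "x \<noteq> y" for x y
  proof (rule ccontr)
    assume *: "\<not> ?thesis"
    have "limited_packing 2 T (insert x (insert y B))"
      unfolding limited_packing_def
    proof (intro conjI ballI)
      fix v assume v: "v \<in> pverts T"
      have ins: "card (closed_nbhd T v \<inter> insert z B) \<le> 2" if "z \<in> pverts T" for z
        using limited_packing_insert[OF D(3) B(1) that] v by (simp add: limited_packing_def numeral_2_eq_2)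
      \<comment> \<open>A closed neighbourhood missing \<open>B\<close> gains at most
        \<open>x\<close> and \<open>y\<close>; one that meets \<open>B\<close> contains at most one
        of them.\<close>
      consider "closed_nbhd T v \<inter> B = {}" | "x \<notin> closed_nbhd T v" | "y \<notin> closed_nbhd T v"
        using * v by blast
      then show "card (closed_nbhd T v \<inter> insert x (insert y B)) \<le> 2"
      proof cases
        case 1
        then have "closed_nbhd T v \<inter> insert x (insert y B) \<subseteq> {x, y}" by auto
        then have "card (closed_nbhd T v \<inter> insert x (insert y B)) \<le> card {x, y}" by (intro card_mono) auto
        then show ?thesis using xy(3) by simp
      next
        case 2
        then show ?thesis using ins[of y] xy(2) by simp
      next
        case 3
        then have "closed_nbhd T v \<inter> insert x (insert y B) = closed_nbhd T v \<inter> insert x B" by auto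
        then show ?thesis using ins[of x] xy(1) by simp
      qed
    qed (use xy BV in auto)
    then have "card (insert x (insert y B)) \<le> limited_packing_number 2 T" by (rule limited_packing_le[OF D(3)])
    then show False using eq B(2) xy fB by simp
  qed
  obtain c where c: "c \<in> pverts T" "pverts T - B \<subseteq> closed_nbhd T c"
    using tree_helly[OF T, of "pverts T - B"] conn BV by blast
  define Y where "Y = pverts T - closed_nbhd T c"
  have YB: "Y \<subseteq> B" using c(2) by (auto simp: Y_def)
  have YV: "Y \<subseteq> pverts T" by (auto simp: Y_def)
  have indep: "v \<notin> B" if "(u, v) \<in> parcs T" "u \<in> B" for u v
    using uniq[of u u v] that D(4,7) by (auto simp: closed_nbhd_def)
  \<comment> \<open>\<open>B\<close> is independent and contains \<open>Y\<close>, so neighbours of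
    \<open>a\<close> lie outside \<open>B\<close>, hence in the closed neighbourhood of
    \<open>c\<close>.\<close>
  have nbY: "(c, w) \<in> parcs T" if "a \<in> Y" "(a, w) \<in> parcs T" for a w
  proof -
    have "w \<in> closed_nbhd T c" using indep[OF that(2)] that YB D(5) c(2) by blast
    moreover have "w \<noteq> c" using that D(6) by (auto simp: Y_def closed_nbhd_def)
    ultimately show ?thesis by (simp add: closed_nbhd_def)
  qed
  have "\<exists>w. (a, w) \<in> parcs T" if "a \<in> Y" for a using tree_ex_neighbour[OF T] that YV by blast
  then obtain f where f: "\<And>a. a \<in> Y \<Longrightarrow> (a, f a) \<in> parcs T" by metis
  have cY: "c \<notin> Y" by (simp add: Y_def closed_nbhd_def)
  \<comment> \<open>Two neighbours of \<open>a\<close> would have both \<open>a\<close> and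
    \<open>c\<close> as common neighbours.\<close>
  have f_uniq: "(a, w) \<in> parcs T \<longleftrightarrow> w = f a" if "a \<in> Y" for a w
    using tree_unique_common_neighbour[OF T _ _ _ nbY nbY, of w "f a" a a a] f[OF that] that cY by metis
  have inj: "inj_on f Y"
  proof (rule inj_onI)
    fix a b assume ab: "a \<in> Y" "b \<in> Y" "f a = f b"
    then have "a \<in> B" "b \<in> B" "(f a, a) \<in> parcs T" "(f a, b) \<in> parcs T"
      using YB f[OF ab(1)] f[OF ab(2)] D(6) by auto
    then show "a = b" using uniq[of "f a" a b] D(4) by (auto simp: closed_nbhd_def)
  qed
  let ?X = "pverts T - {c} - f ` Y" and ?L = "(\<lambda>a. (a, f a)) ` Y"
  have sp: "spider_data c ?X ?L" "T = spider_graph c ?X ?L"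
    using spider_data_of_tree[OF T c(1) Y_def nbY[OF _ f] f_uniq inj] by auto
  have "card ?L = card Y" by (simp add: card_image inj_on_def)
  then have "spider (card Y) T" using sp spider_iff by blast
  moreover have "card Y < max_degree T"
  proof -
    let ?N = "\<lambda>v. {u. (v, u) \<in> parcs T}"
    have finN: "finite (?N v)" for v by (rule finite_subset[OF _ D(3)]) (use D(5) in auto)
    have deg: "card (?N v) \<le> max_degree T" if "v \<in> pverts T" for v
      unfolding max_degree_def out_degree_pair[symmetric] using D(3) that by simp
    have sub: "f ` Y \<subseteq> ?N c" using nbY f by auto
    show ?thesis
    proof (cases "f ` Y = ?N c")
      case False
      then have "card (f ` Y) < card (?N c)" using sub finN by (metis psubsetI psubset_card_mono)
      then show ?thesis using deg[OF c(1)] inj by (simp add: card_image)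
    next
      case True
      have nB: "w \<notin> B" if "w \<in> f ` Y" for w using that f indep YB by blast
      have ne: "f ` Y \<noteq> {}" using True tree_ex_neighbour[OF T c(1)] by blast
      then obtain a where a: "a \<in> Y" by blast
      \<comment> \<open>\<open>c\<close> and \<open>a\<close> both lie in the closed neighbourhood
        of \<open>f a\<close>, and \<open>a\<close> is in \<open>B\<close>.\<close>
      have cB: "c \<notin> B"
        using uniq[of "f a" a c] D(5,6)[OF f[OF a]] D(6)[OF nbY[OF a f[OF a]]] a cY YB
        by (auto simp: closed_nbhd_def)
      have "x = y" if xy: "x \<in> f ` Y" "y \<in> f ` Y" for x y
      proof (rule ccontr)
        assume "x \<noteq> y"
        have adj: "(c, x) \<in> parcs T" "(c, y) \<in> parcs T" using xy sub by auto
        obtain v where v: "v \<in> pverts T" "x \<in> closed_nbhd T v" "y \<in> closed_nbhd T v" "closed_nbhd T v \<inter> B \<noteq> {}"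
          using conn[of x y] xy nB adj D(5) \<open>x \<noteq> y\<close> by blast
        have "(x, y) \<notin> parcs T" "(y, x) \<notin> parcs T" using tree_no_triangle[OF T adj(1) _ adj(2)] D(6) by blast+
        then have "(v, x) \<in> parcs T" "(v, y) \<in> parcs T" using v(2,3) \<open>x \<noteq> y\<close> by (auto simp: closed_nbhd_def)
        then have "v = c" using tree_unique_common_neighbour[OF T \<open>x \<noteq> y\<close>] adj by blast
        then show False using v(4) cB nB True by (auto simp: closed_nbhd_def)
      qed
      then have "f ` Y = {f a}" using a by blast
      then have "card Y = 1" using inj by (metis card_image is_singletonI is_singleton_altdef)
      \<comment> \<open>With a single far leaf the degree of \<open>c\<close> is only
        \<open>card Y\<close>; the subdividing vertex \<open>f a\<close> supplies degree 2.\<close>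
      moreover have "{a, c} \<subseteq> ?N (f a)" using f[OF a] nbY[OF a f[OF a]] D(6) by blast
      then have "card {a, c} \<le> card (?N (f a))" using finN card_mono by blast
      moreover have "a \<noteq> c" using a cY by auto
      ultimately have "card Y = 1" "2 \<le> card (?N (f a))" by simp_all
      then show ?thesis using deg[of "f a"] D(5)[OF f[OF a]] by simp
    qed
  qed
  ultimately show ?thesis by blast
qed

theorem theorem5p3:
  fixes T :: "'a pair_pre_digraph"
  assumes "undirected_tree T"
  shows "limited_packing_number 1 T + 1 \<le> limited_packing_number 2 T
       \<and> limited_packing_number 2 T \<le> 2 * limited_packing_number 1 T
       \<and> (limited_packing_number 1 T + 1 = limited_packing_number 2 T
            \<longleftrightarrow> (\<exists>t. 0 \<le> t \<and> t < max_degree T \<and> spider t T))"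
proof (intro conjI iffI)
  show lower: "limited_packing_number 1 T + 1 \<le> limited_packing_number 2 T"
    using limited_packing_number_1_less[OF assms] .
  show "limited_packing_number 2 T \<le> 2 * limited_packing_number 1 T"
    using limited_packing_number_2_le[OF assms] .
  show "\<exists>t. 0 \<le> t \<and> t < max_degree T \<and> spider t T"
    if "limited_packing_number 1 T + 1 = limited_packing_number 2 T"
    using tight_packing_imp_spider[OF assms that] by auto
  show "limited_packing_number 1 T + 1 = limited_packing_number 2 T"
    if sp: "\<exists>t. 0 \<le> t \<and> t < max_degree T \<and> spider t T"
  proof -
    obtain c X L where "spider_data c X L" "T = spider_graph c X L" "card L < max_degree T"
      using sp unfolding spider_iff by blast
    then show ?thesis using spider_packing_numbers lower by (metis le_antisym)
  qed
qed

end
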